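(* Let $d$ be a nonnegative integer. (i) Let $V$ be a finite set with $|V| = n$, let $r$ be a nonnegative integer with $d + r \le n$, and let $K$ be a $d$-collapsible simplicial complex on $V$ with $\dim(K) \le d + r - 1$. Let $H$ be the $(d+1)$-uniform hypergraph on $V$ whose edges are exactly the $(d+1)$-element subsets of $V$ that are not faces of $K$. Then $H$ is weakly $K^{(d+1)}_{\mathbf m}$-saturated in the complete $(d+1)$-uniform hypergraph $K^{(d+1)}_n$ on $V$, where $\mathbf m = (1, \ldots, 1, n - d - r + 1)$ is the $(d+1)$-tuple whose first $d$ entries equal $1$ and whose last entry equals $n-d-r+1$. (ii) Let $V$ be a finite set with a partition $V = V_1 \cup \cdots \cup V_{d+1}$, and let $r_1, \ldots, r_{d+1}$ be nonnegative integers such that $|V_i| = n_i \ge r_i$ for every $i \in [d+1]$; write $\mathbf n = (n_1, \ldots, n_{d+1})$. Let $K$ be a $d$-collapsible simplicial complex on $V$ with $\dim(K[V_i]) \le r_i - 1$ for every $i \in [d+1]$. Let $H$ be the $(d+1)$-partite $(d+1)$-uniform hypergraph with vertex partition $(V_1, \ldots, V_{d+1})$ whose edges are exactly the rainbow sets of size $d+1$ (i.e., sets containing exactly one element from each $V_i$) that are not faces of $K$. For every $i \in [d+1]$, let $\mathbf m_i = (1, \ldots, 1, n_i - r_i + 1, 1, \ldots, 1)$ be the $(d+1)$-tuple whose $i$-th entry is $n_i - r_i + 1$ and all other entries equal $1$. Then $H$ is directed weakly $\{K^{(d+1)}_{\mathbf m_1}, \ldots, K^{(d+1)}_{\mathbf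 m_{d+1}}\}$-saturated in the host hypergraph $K^{(d+1)}_{\mathbf n}$ with vertex partition $(V_1, \ldots, V_{d+1})$.
   Context: Simplicial complexes are abstract simplicial complexes on a finite vertex set; $\dim\sigma := |\sigma| - 1$ and $\dim(K) := \max_{\sigma\in K} \dim \sigma$; $K[W]$ denotes the subcomplex of faces of $K$ contained in $W$. An elementary $d$-collapse in $K$ is the operation of choosing a face $\sigma$ of size at most $d$ that is contained in a unique maximal face of $K$ and deleting all faces of $K$ containing $\sigma$. $K$ is $d$-collapsible if all faces can be removed by a finite sequence of elementary $d$-collapses. An $r$-graph is an $r$-uniform hypergraph. $K^{(r)}_n$ denotes the complete $r$-graph on $n$ vertices. For a tuple $\mathbf m = (m_1, \ldots, m_r)$ of positive integers, $K^{(r)}_{\mathbf m}$ denotes the complete $r$-partite $r$-graph with vertex partition $(U_1, \ldots, U_r)$, $|U_i| = m_i$ (edges: all sets with exactly one vertex in each $U_i$). For hypergraphs $H \subseteq G$ on the same vertex set and $H \cup \{e_1,\dots,e_k\}$ denoting $H$ with edges $e_1,\dots,e_k$ added, and a family $\mathcal F$ of hypergraphs, $H$ is weakly $\mathcal F$-saturated in $G$ if there is an ordering $e_1, \ldots, e_m$ of $E(G) \setminus E(H)$ such that for every $k \in [m]$, $H \cup \{e_1, \ldots, e_k\}$ contains a copy of some member of $\mathcal F$ that uses the edge $e_k$ (for a single hypergraph $F$, weakly $F$-saturated means weakly $\{F\}$-saturated). In the $r$-partite setting, where $G, H$ have a fixed vertex partition $(V_1, \ldots, V_r)$ and each $F \in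 \mathcal F$ has a fixed partition $(U_1, \ldots, U_r)$, a copy of $F$ is directed if its embedding $\varphi$ satisfies $\varphi(U_i) \subseteq V_i$ for all $i$; $H$ is directed weakly $\mathcal F$-saturated if such an ordering exists where at each step the copy containing $e_k$ is a directed copy of some member of $\mathcal F$. *)

theory Defs
  imports Main
begin

text \<open>Complexes are families of finite sets. The elements of the ground set need not be vertices
  of the complex, and the void complex is allowed.\<close>

definition simplicial_complex_on :: "'a set \<Rightarrow> 'a set set \<Rightarrow> bool" where
  "simplicial_complex_on V K \<longleftrightarrow>
     finite V \<and> K \<subseteq> Pow V \<and> (\<forall>\<sigma>\<in>K. \<forall>\<tau>. \<tau> \<subseteq> \<sigma> \<longrightarrow> \<tau> \<in> K)"

definition face_dim :: "'a set \<Rightarrow> int" where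
  "face_dim \<sigma> = int (card \<sigma>) - 1"

text \<open>The complex whose only face is the empty set has dimension \<open>-1\<close>; the void complex is given
  the same dimension.\<close>

definition complex_dim :: "'a set set \<Rightarrow> int" where
  "complex_dim K = (if K = {} then -1 else Max (face_dim ` K))"

definition induced_subcomplex :: "'a set set \<Rightarrow> 'a set \<Rightarrow> 'a set set" where
  "induced_subcomplex K W = {\<sigma> \<in> K. \<sigma> \<subseteq> W}"

definition maximal_face :: "'a set set \<Rightarrow> 'a set \<Rightarrow> bool" where
  "maximal_face K \<tau> \<longleftrightarrow> \<tau> \<in> K \<and> (\<forall>\<rho>\<in>K. \<tau> \<subseteq> \<rho> \<longrightarrow> \<rho> = \<tau>)"

definition elementary_collapse :: "nat \<Rightarrow> 'a set set \<Rightarrow> 'a set set \<Rightarrow> bool" where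
  "elementary_collapse d K K' \<longleftrightarrow>
     (\<exists>\<sigma>\<in>K. card \<sigma> \<le> d \<and> (\<exists>!\<tau>. maximal_face K \<tau> \<and> \<sigma> \<subseteq> \<tau>) \<and> K' = {\<rho> \<in> K. \<not> \<sigma> \<subseteq> \<rho>})"

text \<open>The empty face has to be removed as well, so the target is the void complex.\<close>

definition collapsible :: "nat \<Rightarrow> 'a set set \<Rightarrow> bool" where
  "collapsible d K \<longleftrightarrow> (elementary_collapse d)\<^sup>*\<^sup>* K {}"

record 'a hypergraph =
  verts :: "'a set"
  edges :: "'a set set"

record 'a partite_hypergraph = "'a hypergraph" +
  parts :: "'a set list"

definition complete_hypergraph :: "nat \<Rightarrow> 'a set \<Rightarrow> 'a hypergraph" where
  "complete_hypergraph r V = \<lparr>verts = V, edges = {e. e \<subseteq> V \<and> card e = r}\<rparr>"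

text \<open>Ordered partitions; parts may be empty.\<close>

definition ordered_partition :: "'a set \<Rightarrow> 'a set list \<Rightarrow> bool" where
  "ordered_partition V Vs \<longleftrightarrow> \<Union>(set Vs) = V \<and>
     (\<forall>i<length Vs. \<forall>j<length Vs. i \<noteq> j \<longrightarrow> Vs ! i \<inter> Vs ! j = {})"

definition rainbow :: "'a set list \<Rightarrow> 'a set \<Rightarrow> bool" where
  "rainbow Vs e \<longleftrightarrow> e \<subseteq> \<Union>(set Vs) \<and> (\<forall>i<length Vs. card (e \<inter> Vs ! i) = 1)"

definition complete_partite_on :: "'a set list \<Rightarrow> 'a partite_hypergraph" where
  "complete_partite_on Vs = \<lparr>verts = \<Union>(set Vs), edges = {e. rainbow Vs e}, parts = Vs\<rparr>"

text \<open>A concrete model of the complete partite hypergraph with part sizes \<open>m\<close>: the \<open>i\<close>-th part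
  (counted from \<open>0\<close>) is \<open>{i} \<times> {..<m ! i}\<close>.\<close>

definition complete_partite :: "nat list \<Rightarrow> (nat \<times> nat) partite_hypergraph" where
  "complete_partite m = complete_partite_on (map (\<lambda>i. {i} \<times> {..<m ! i}) [0..<length m])"

definition add_edges :: "('a, 'x) hypergraph_scheme \<Rightarrow> 'a set set \<Rightarrow> ('a, 'x) hypergraph_scheme"
  where "add_edges H E = H\<lparr>edges := edges H \<union> E\<rparr>"

definition embedding ::
  "('b, 'y) hypergraph_scheme \<Rightarrow> ('a, 'x) hypergraph_scheme \<Rightarrow> ('b \<Rightarrow> 'a) \<Rightarrow> bool" where
  "embedding F G \<phi> \<longleftrightarrow> inj_on \<phi> (verts F) \<and> \<phi> ` verts F \<subseteq> verts G \<and> (\<forall>f\<in>edges F. \<phi> ` f \<in> edges G)"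

definition directed_embedding ::
  "'b partite_hypergraph \<Rightarrow> 'a partite_hypergraph \<Rightarrow> ('b \<Rightarrow> 'a) \<Rightarrow> bool" where
  "directed_embedding F G \<phi> \<longleftrightarrow> embedding F G \<phi> \<and> length (parts F) = length (parts G) \<and>
     (\<forall>i<length (parts F). \<phi> ` (parts F ! i) \<subseteq> parts G ! i)"

definition weakly_saturated ::
  "('b, 'y) hypergraph_scheme set \<Rightarrow> ('a, 'x) hypergraph_scheme \<Rightarrow> ('a, 'x) hypergraph_scheme \<Rightarrow> bool"
  where
  "weakly_saturated \<F> H G \<longleftrightarrow> verts H = verts G \<and> edges H \<subseteq> edges G \<and>
     (\<exists>es. distinct es \<and> set es = edges G - edges H \<and>
       (\<forall>k<length es. \<exists>F\<in>\<F>. \<exists>\<phi>. embedding F (add_edges H (set (take (Suc k) es))) \<phi> \<and>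
          (\<exists>f\<in>edges F. \<phi> ` f = es ! k)))"

definition directed_weakly_saturated ::
  "'b partite_hypergraph set \<Rightarrow> 'a partite_hypergraph \<Rightarrow> 'a partite_hypergraph \<Rightarrow> bool" where
  "directed_weakly_saturated \<F> H G \<longleftrightarrow>
     verts H = verts G \<and> parts H = parts G \<and> edges H \<subseteq> edges G \<and>
     (\<exists>es. distinct es \<and> set es = edges G - edges H \<and>
       (\<forall>k<length es. \<exists>F\<in>\<F>. \<exists>\<phi>. directed_embedding F (add_edges H (set (take (Suc k) es))) \<phi> \<and>
          (\<exists>f\<in>edges F. \<phi> ` f = es ! k)))"

definition missing_hypergraph :: "nat \<Rightarrow> 'a set \<Rightarrow> 'a set set \<Rightarrow> 'a hypergraph" where
  "missing_hypergraph r V K = \<lparr>verts = V, edges = {e. e \<subseteq> V \<and> card e = r \<and> e \<notin> K}\<rparr>"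

definition missing_rainbow_hypergraph :: "'a set list \<Rightarrow> 'a set set \<Rightarrow> 'a partite_hypergraph" where
  "missing_rainbow_hypergraph Vs K =
     \<lparr>verts = \<Union>(set Vs), edges = {e. rainbow Vs e \<and> e \<notin> K}, parts = Vs\<rparr>"

end

theory Submission
  imports Defs
begin

text \<open>
  Add the missing edges in the order in which the collapses delete them. Suppose \<open>\<sigma>\<close> is collapsed
  inside the unique maximal face \<open>\<tau>\<close>, and \<open>e\<close> is an edge with \<open>\<sigma> \<subseteq> e \<subseteq> \<tau>\<close>. Since
  \<open>|\<sigma>| \<le> d < |e|\<close>, some vertex of \<open>e\<close> lies outside \<open>\<sigma>\<close>; exchanging it for a vertex outside \<open>\<tau>\<close>
  gives a set containing \<open>\<sigma>\<close> but not contained in \<open>\<tau>\<close>, hence an edge that is already present.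
  The dimension bound on \<open>\<tau>\<close> leaves enough vertices outside \<open>\<tau>\<close>, so \<open>e\<close> completes a star whose
  centre has \<open>d\<close> elements. In the partite case the exchanged vertex is taken in a part missed
  by \<open>\<sigma>\<close>.
\<close>

section \<open>Ordering edges along a sequence of collapses\<close>

lemma subset_maximal_face:
  assumes "finite K" "\<rho> \<in> K"
  obtains \<tau> where "maximal_face K \<tau>" "\<rho> \<subseteq> \<tau>"
  using finite_has_maximal2[OF assms] unfolding maximal_face_def by metis

text \<open>When \<sigma> is collapsed inside \<tau>, all remaining faces containing \<sigma> lie in
  \<tau>, so an edge of \<open>E \<inter> K\<close> that contains \<sigma> but leaves \<tau> was
  deleted strictly earlier. Membership of \<tau> in the initial \<open>K\<close> is recorded because
  the dimension bounds concern that complex. Leaving \<open>E\<close> arbitrary serves both the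
  uniform and the rainbow edges.\<close>

lemma collapse_edge_order:
  assumes "(elementary_collapse d)\<^sup>*\<^sup>* K {}" "finite K"
  shows "\<exists>es. distinct es \<and> set es = E \<inter> K \<and>
    (\<forall>k<length es. \<exists>\<sigma> \<tau>. card \<sigma> \<le> d \<and> \<sigma> \<subseteq> es ! k \<and> es ! k \<subseteq> \<tau> \<and> \<tau> \<in> K \<and>
       (\<forall>e\<in>E \<inter> K. \<sigma> \<subseteq> e \<longrightarrow> \<not> e \<subseteq> \<tau> \<longrightarrow> e \<in> set (take k es)))"
  using assms
proof (induction rule: converse_rtranclp_induct)
  case base
  then show ?case by auto
next
  case (step K K')
  from step.hyps(1) obtain \<sigma> \<tau> where \<sigma>: "card \<sigma> \<le> d" and K': "K' = {\<rho> \<in> K. \<not> \<sigma> \<subseteq> \<rho>}"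
    and \<tau>: "maximal_face K \<tau>" and uniq: "\<And>\<tau>'. maximal_face K \<tau>' \<Longrightarrow> \<sigma> \<subseteq> \<tau>' \<Longrightarrow> \<tau>' = \<tau>"
    unfolding elementary_collapse_def by metis
  have \<tau>K: "\<tau> \<in> K"
    using \<tau> by (simp add: maximal_face_def)
  \<comment> \<open>A maximal face above \<rho> also contains \<sigma>, so by uniqueness it is
    \<tau>.\<close>
  have below: "\<rho> \<subseteq> \<tau>" if "\<rho> \<in> K" "\<sigma> \<subseteq> \<rho>" for \<rho>
    by (metis subset_maximal_face[OF step.prems that(1)] uniq that(2) subset_trans)
  have "finite K'"
    using step.prems K' by simp
  then obtain es' where es': "distinct es'" "set es' = E \<inter> K'"
    and steps: "\<forall>k<length es'. \<exists>\<sigma> \<tau>. card \<sigma> \<le> d \<and> \<sigma> \<subseteq> es' ! k \<and> es' ! k \<subseteq> \<tau> \<and> \<tau> \<in> K' \<and>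
       (\<forall>e\<in>E \<inter> K'. \<sigma> \<subseteq> e \<longrightarrow> \<not> e \<subseteq> \<tau> \<longrightarrow> e \<in> set (take k es'))"
    using step.IH by blast
  have "finite {e \<in> E \<inter> K. \<sigma> \<subseteq> e}"
    using step.prems by simp
  then obtain es0 where es0: "distinct es0" "set es0 = {e \<in> E \<inter> K. \<sigma> \<subseteq> e}"
    using finite_distinct_list by metis
  \<comment> \<open>The edges removed by the first collapse come first; their mutual order is
    immaterial, as all of them lie in \<tau>.\<close>
  let ?es = "es0 @ es'"
  have "\<exists>\<sigma> \<tau>. card \<sigma> \<le> d \<and> \<sigma> \<subseteq> ?es ! k \<and> ?es ! k \<subseteq> \<tau> \<and> \<tau> \<in> K \<and>
       (\<forall>e\<in>E \<inter> K. \<sigma> \<subseteq> e \<longrightarrow> \<not> e \<subseteq> \<tau> \<longrightarrow> e \<in> set (take k ?es))" if k: "k < length ?es" for k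
  proof (cases "k < length es0")
    \<comment> \<open>By \<open>below\<close>, no edge containing \<sigma> leaves \<tau>, so the
      last condition holds vacuously.\<close>
    case True
    then have "es0 ! k \<in> E \<inter> K" "\<sigma> \<subseteq> es0 ! k"
      using es0(2) nth_mem by blast+
    then show ?thesis
      using True \<sigma> \<tau>K below
      by (rule_tac x = \<sigma> in exI, rule_tac x = \<tau> in exI) (auto simp: nth_append)
  next
    case False
    let ?j = "k - length es0"
    have j: "?j < length es'"
      using False k by simp
    obtain \<sigma>' \<tau>' where *: "card \<sigma>' \<le> d" "\<sigma>' \<subseteq> es' ! ?j" "es' ! ?j \<subseteq> \<tau>'" "\<tau>' \<in> K'"
       "\<forall>e\<in>E \<inter> K'. \<sigma>' \<subseteq> e \<longrightarrow> \<not> e \<subseteq> \<tau>' \<longrightarrow> e \<in> set (take ?j es')"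
      using steps[THEN spec, THEN mp, OF j] by (elim exE conjE) (rule that)
    \<comment> \<open>An edge containing the first collapsed face \<sigma> is in \<open>es0\<close>,
      which the prefix includes entirely; any other edge survives in \<open>K'\<close> and is
      covered by the induction hypothesis.\<close>
    have "e \<in> set (take k ?es)" if "e \<in> E \<inter> K" "\<sigma>' \<subseteq> e" "\<not> e \<subseteq> \<tau>'" for e
      using * that False K' es0(2) by (cases "\<sigma> \<subseteq> e") auto
    then show ?thesis
      using *(1-4) False K'
      by (rule_tac x = \<sigma>' in exI, rule_tac x = \<tau>' in exI) (simp add: nth_append)
  qed
  moreover have "distinct ?es" "set ?es = E \<inter> K"
    using es0 es' K' by auto
  ultimately show ?case by blast
qed

section \<open>Copies of complete partite hypergraphs with one large part\<close>

text \<open>With all parts but the \<open>i\<close>-th singletons, an edge is determined by its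
  vertex in part \<open>i\<close>, so a copy is a star with centre \<open>S\<close> and leaves
  \<open>X\<close>. The final clause locates the image of each part, which is what directed copies
  require.\<close>

lemma star_embedding:
  fixes G :: "('a, 'x) hypergraph_scheme" and X :: "'a set" and d i :: nat
  defines "F \<equiv> complete_partite ((replicate (d + 1) 1)[i := card X])"
  assumes i: "i < d + 1" and X: "finite X" "x0 \<in> X"
    and s: "inj_on s ({..<d + 1} - {i})" and S: "S = s ` ({..<d + 1} - {i})"
    and disj: "X \<inter> S = {}" and sub: "X \<union> S \<subseteq> verts G"
    and edge: "\<And>x. x \<in> X \<Longrightarrow> insert x S \<in> edges G"
  shows "\<exists>\<phi>. embedding F G \<phi> \<and> (\<exists>f\<in>edges F. \<phi> ` f = insert x0 S) \<and> length (parts F) = d + 1 \<and>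
    (\<forall>j<d + 1. \<phi> ` (parts F ! j) \<subseteq> (if j = i then X else {s j}))"
proof -
  obtain g where g: "bij_betw g {..<card X} X"
    using ex_bij_betw_nat_finite[OF X(1)] by (auto simp: atLeast0LessThan)
  then obtain k0 where k0: "k0 < card X" "g k0 = x0"
    using X(2) unfolding bij_betw_def by (metis imageE lessThan_iff)
  \<comment> \<open>Part \<open>i\<close> is enumerated onto the leaves by \<open>g\<close>; the
    only vertex of any other part \<open>j\<close> goes to the centre vertex
    \<open>s j\<close>.\<close>
  define \<phi> where "\<phi> = (\<lambda>(j, k). if j = i then g k else s j)"
  define B where "B = (\<lambda>j. {j} \<times> {..<if j = i then card X else (1::nat)})"
  have parts: "parts F = map B [0..<d + 1]"
    unfolding F_def complete_partite_def complete_partite_on_def B_def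
    by (auto simp: nth_list_update simp del: replicate_Suc upt_Suc)
  have verts: "verts F = (\<Union>j<d + 1. B j)" and edges: "edges F = {f. rainbow (map B [0..<d + 1]) f}"
    using parts unfolding F_def complete_partite_def complete_partite_on_def
    by (simp_all add: atLeast0LessThan del: upt_Suc)
  have gX: "g k \<in> X" if "k < card X" for k
    using g that by (auto simp: bij_betw_def)
  have gi: "inj_on g {..<card X}"
    using g by (simp add: bij_betw_def)
  have sS: "s j \<in> S" if "j < d + 1" "j \<noteq> i" for j
    using that S by auto
  have split_i: "h ` {..<d + 1} = insert (h i) (h ` ({..<d + 1} - {i}))" for h :: "nat \<Rightarrow> 'a"
    using i by auto
  have "inj_on \<phi> (verts F)"
  proof (rule inj_onI)
    fix p q assume pq: "p \<in> verts F" "q \<in> verts F" "\<phi> p = \<phi> q"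
    obtain j k j' k' where [simp]: "p = (j, k)" "q = (j', k')"
      by (cases p, cases q) blast
    have jk: "j < d + 1" "k < (if j = i then card X else 1)"
      "j' < d + 1" "k' < (if j' = i then card X else 1)"
      using pq(1,2) by (auto simp: verts B_def)
    show "p = q"
    proof (cases "j = i"; cases "j' = i")
      assume "j = i" "j' = i"
      then show ?thesis
        using pq(3) jk inj_onD[OF gi, of k k'] by (simp add: \<phi>_def)
    next
      assume "j \<noteq> i" "j' \<noteq> i"
      then show ?thesis
        using pq(3) jk inj_onD[OF s, of j j'] by (simp add: \<phi>_def)
    next
      assume "j = i" "j' \<noteq> i"
      then show ?thesis
        using pq(3) jk gX[of k] sS[of j'] disj by (auto simp: \<phi>_def)
    next
      assume "j \<noteq> i" "j' = i"
      then show ?thesis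
        using pq(3) jk gX[of k'] sS[of j] disj by (auto simp: \<phi>_def)
    qed
  qed
  moreover have \<phi>B: "\<phi> ` B j \<subseteq> (if j = i then X else {s j})" if "j < d + 1" for j
    using gX by (auto simp: \<phi>_def B_def)
  then have "\<phi> ` verts F \<subseteq> X \<union> S"
    using sS unfolding verts by (fastforce split: if_splits)
  moreover have "\<phi> ` f \<in> edges G" if "f \<in> edges F" for f
  proof -
    have "rainbow (map B [0..<d + 1]) f"
      using that edges by simp
    then have fsub: "f \<subseteq> (\<Union>j<d + 1. B j)" and "\<forall>j<d + 1. card (f \<inter> B j) = 1"
      unfolding rainbow_def by (auto simp: atLeast0LessThan simp del: upt_Suc)
    \<comment> \<open>An edge of \<open>F\<close> is a transversal \<open>p\<close> of the parts;
      outside part \<open>i\<close> its image is forced to be \<open>S\<close>.\<close>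
    then have "\<forall>j<d + 1. \<exists>p. f \<inter> B j = {p}"
      by (simp add: card_1_singleton_iff)
    then obtain p where p: "\<And>j. j < d + 1 \<Longrightarrow> f \<inter> B j = {p j}"
      by metis
    have f: "f = p ` {..<d + 1}"
    proof
      show "f \<subseteq> p ` {..<d + 1}"
        using fsub p by blast
      show "p ` {..<d + 1} \<subseteq> f"
        using p by blast
    qed
    have \<phi>p: "\<phi> (p j) \<in> (if j = i then X else {s j})" if "j < d + 1" for j
      using p[OF that] \<phi>B[OF that] by blast
    have "\<phi> ` f = insert (\<phi> (p i)) ((\<lambda>j. \<phi> (p j)) ` ({..<d + 1} - {i}))"
      unfolding f image_image by (rule split_i)
    also have "(\<lambda>j. \<phi> (p j)) ` ({..<d + 1} - {i}) = S"
      unfolding S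
    proof (rule image_cong)
      show "\<phi> (p j) = s j" if "j \<in> {..<d + 1} - {i}" for j
        using \<phi>p[of j] that by simp
    qed simp
    finally show ?thesis
      using edge \<phi>p[OF i] by simp
  qed
  ultimately have "embedding F G \<phi>"
    using sub unfolding embedding_def by blast
  moreover have "\<exists>f\<in>edges F. \<phi> ` f = insert x0 S"
  proof (rule bexI)
    \<comment> \<open>The edge through the prescribed leaf: \<open>k0\<close> is the index of
      \<open>x0\<close> under \<open>g\<close>, and 0 is the only index in a singleton part.\<close>
    let ?p = "\<lambda>j. (j, if j = i then k0 else 0)"
    have "?p ` {..<d + 1} \<inter> B j = {?p j}" if "j < d + 1" for j
      using k0 that by (auto simp: B_def)
    moreover have "?p ` {..<d + 1} \<subseteq> (\<Union>j<d + 1. B j)"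
      using k0 by (auto simp: B_def)
    ultimately show "?p ` {..<d + 1} \<in> edges F"
      unfolding edges rainbow_def by (simp add: atLeast0LessThan del: upt_Suc)
    have "\<phi> ` ?p ` {..<d + 1} = insert (\<phi> (?p i)) ((\<lambda>j. \<phi> (?p j)) ` ({..<d + 1} - {i}))"
      unfolding image_image by (rule split_i)
    also have "(\<lambda>j. \<phi> (?p j)) ` ({..<d + 1} - {i}) = S"
      unfolding S by (intro image_cong) (auto simp: \<phi>_def)
    finally show "\<phi> ` ?p ` {..<d + 1} = insert x0 S"
      using k0 by (simp add: \<phi>_def)
  qed
  ultimately show ?thesis
    using \<phi>B parts by (intro exI[of _ \<phi>]) (auto simp del: upt_Suc)
qed

section \<open>Size bounds for faces and complexes\<close>

lemma card_face_le_of_complex_dim: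
  assumes "finite K" "\<tau> \<in> K" "complex_dim K \<le> int m - 1"
  shows "card \<tau> \<le> m"
proof -
  have "face_dim \<tau> \<le> Max (face_dim ` K)"
    using assms by simp
  then show ?thesis
    using assms by (auto simp: complex_dim_def face_dim_def split: if_splits)
qed

lemma finite_simplicial_complex: "simplicial_complex_on V K \<Longrightarrow> finite K"
  unfolding simplicial_complex_on_def by (meson finite_Pow_iff finite_subset)

section \<open>The uniform case\<close>

text \<open>A face \<tau> has at most \<open>d + r\<close> vertices, so at least
  \<open>card V - d - r\<close> vertices lie outside it; these and the exchanged vertex of the
  current edge form the large part.\<close>

theorem missing_hypergraph_weakly_saturated:
  fixes V :: "'a set"
  assumes V: "finite V"
    and K: "simplicial_complex_on V K" and coll: "collapsible d K"
    and dim: "complex_dim K \<le> int d + int r - 1"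
  shows "weakly_saturated {complete_partite (replicate d 1 @ [card V - d - r + 1])}
    (missing_hypergraph (d + 1) V K) (complete_hypergraph (d + 1) V)"
    (is "weakly_saturated {?F} ?H ?G")
proof -
  define E where "E = {e. e \<subseteq> V \<and> card e = d + 1}"
  note fK = finite_simplicial_complex[OF K]
  obtain es where es: "distinct es" "set es = E \<inter> K"
    and steps: "\<forall>k<length es. \<exists>\<sigma> \<tau>. card \<sigma> \<le> d \<and> \<sigma> \<subseteq> es ! k \<and> es ! k \<subseteq> \<tau> \<and> \<tau> \<in> K \<and>
       (\<forall>e\<in>E \<inter> K. \<sigma> \<subseteq> e \<longrightarrow> \<not> e \<subseteq> \<tau> \<longrightarrow> e \<in> set (take k es))"
    using collapse_edge_order[OF coll[unfolded collapsible_def] fK, of E]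
    by (elim exE conjE) (rule that)
  have "\<exists>\<phi>. embedding ?F (add_edges ?H (set (take (Suc k) es))) \<phi> \<and> (\<exists>f\<in>edges ?F. \<phi> ` f = es ! k)"
    if k: "k < length es" for k
  proof -
    let ?G' = "add_edges ?H (set (take (Suc k) es))"
    obtain \<sigma> \<tau> where \<sigma>: "card \<sigma> \<le> d" "\<sigma> \<subseteq> es ! k" and \<tau>: "es ! k \<subseteq> \<tau>" "\<tau> \<in> K"
      and new: "\<forall>e\<in>E \<inter> K. \<sigma> \<subseteq> e \<longrightarrow> \<not> e \<subseteq> \<tau> \<longrightarrow> e \<in> set (take k es)"
      using steps[THEN spec, THEN mp, OF k] by (elim exE conjE) (rule that)
    have take: "set (take (Suc k) es) = insert (es ! k) (set (take k es))"
      using k by (simp add: take_Suc_conv_app_nth)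
    \<comment> \<open>A non-face is an edge of \<open>?H\<close> from the start; a face was added
      earlier, by \<open>new\<close>.\<close>
    have present: "e \<in> edges ?G'" if "e \<in> E" "\<sigma> \<subseteq> e" "\<not> e \<subseteq> \<tau>" for e
      using that new unfolding add_edges_def missing_hypergraph_def take E_def by auto
    have ek: "es ! k \<in> E" "es ! k \<in> edges ?G'"
      using k es(2) nth_mem unfolding add_edges_def take by fastforce+
    have fin: "finite (es ! k)" and cek: "card (es ! k) = d + 1" and ekV: "es ! k \<subseteq> V"
      using ek(1) V finite_subset by (auto simp: E_def)
    have "\<sigma> \<noteq> es ! k"
      using \<sigma>(1) cek by auto
    then obtain x0 where x0: "x0 \<in> es ! k" "x0 \<notin> \<sigma>"
      using \<sigma>(2) by blast
    \<comment> \<open>Since \<open>x0\<close> is outside \<sigma>, this centre still contains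
      \<sigma>, and so does every edge of the star.\<close>
    define S where "S = es ! k - {x0}"
    have S: "finite S" "card S = d" "insert x0 S = es ! k" "\<sigma> \<subseteq> S" "S \<subseteq> \<tau>" "S \<subseteq> V"
      using x0 fin cek \<sigma>(2) \<tau>(1) ekV by (auto simp: S_def)
    \<comment> \<open>The large part is the last one, with index \<open>d\<close> when counting from
      0, so the singleton parts have the indices below \<open>d\<close>.\<close>
    obtain s where "bij_betw s {..<d} S"
      using ex_bij_betw_nat_finite[OF S(1)] S(2) by (auto simp: atLeast0LessThan)
    moreover have "{..<d + 1} - {d} = {..<d}"
      by auto
    ultimately have s: "inj_on s ({..<d + 1} - {d})" "S = s ` ({..<d + 1} - {d})"
      by (simp_all add: bij_betw_def)
    have \<tau>V: "\<tau> \<subseteq> V"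
      using K \<tau>(2) by (auto simp: simplicial_complex_on_def)
    have "card \<tau> \<le> d + r"
      using card_face_le_of_complex_dim[OF fK \<tau>(2), of "d + r"] dim by simp
    then have "card V - d - r \<le> card (V - \<tau>)"
      using \<tau>V V by (simp add: card_Diff_subset finite_subset)
    then obtain X0 where X0: "X0 \<subseteq> V - \<tau>" "card X0 = card V - d - r" "finite X0"
      by (rule obtain_subset_with_card_n)
    define X where "X = insert x0 X0"
    have "x0 \<notin> X0"
      using x0 \<tau>(1) X0(1) by blast
    then have cX: "card X = card V - d - r + 1"
      using X0 by (simp add: X_def)
    have XS: "X \<inter> S = {}"
      using X0(1) S(5) by (auto simp: X_def S_def)
    have XV: "X \<union> S \<subseteq> verts ?G'"
      using X0(1) x0(1) ekV S(6) by (auto simp: X_def add_edges_def missing_hypergraph_def)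
    \<comment> \<open>The leaf \<open>x0\<close> gives the edge just added; any other leaf lies
      outside \<tau>, so \<open>present\<close> applies.\<close>
    have "insert x S \<in> edges ?G'" if "x \<in> X" for x
    proof (cases "x = x0")
      case True
      then show ?thesis
        using ek(2) S(3) by simp
    next
      case False
      then have x: "x \<in> V" "x \<notin> \<tau>"
        using that X0(1) by (auto simp: X_def)
      then have "x \<notin> S"
        using S(5) by blast
      then show ?thesis
        using present[of "insert x S"] x S by (auto simp: E_def)
    qed
    then have "\<exists>\<phi>. embedding (complete_partite ((replicate (d + 1) 1)[d := card X])) ?G' \<phi> \<and>
        (\<exists>f\<in>edges (complete_partite ((replicate (d + 1) 1)[d := card X])). \<phi> ` f = insert x0 S)"
      using star_embedding[OF _ _ _ s XS XV, of x0] X0(3) by (auto simp: X_def simp del: replicate_Suc)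
    moreover have "(replicate (d + 1) 1)[d := card X] = replicate d 1 @ [card V - d - r + 1]"
      unfolding cX replicate_add by (simp add: list_update_append)
    ultimately show ?thesis
      using S(3) by simp
  qed
  moreover have "edges ?G - edges ?H = E \<inter> K" "verts ?H = verts ?G" "edges ?H \<subseteq> edges ?G"
    by (auto simp: E_def complete_hypergraph_def missing_hypergraph_def)
  ultimately show ?thesis
    using es unfolding weakly_saturated_def by (intro conjI exI[of _ es]) simp_all
qed

section \<open>The partite case\<close>

text \<open>Pigeonhole: if \<sigma> met every part, choosing a point in each would inject the part
  indices into \<sigma>.\<close>

lemma ordered_partition_missed_part:
  assumes part: "ordered_partition V Vs" and "finite \<sigma>" "card \<sigma> < length Vs"
  obtains i where "i < length Vs" "\<sigma> \<inter> Vs ! i = {}"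
proof (rule ccontr)
  assume "\<not> thesis"
  then have "\<forall>i<length Vs. \<exists>x. x \<in> \<sigma> \<inter> Vs ! i"
    using that by blast
  then obtain h where h: "\<And>i. i < length Vs \<Longrightarrow> h i \<in> \<sigma> \<inter> Vs ! i"
    by metis
  have "inj_on h {..<length Vs}"
    using h part unfolding ordered_partition_def inj_on_def by (metis IntD2 disjoint_iff lessThan_iff)
  then have "card {..<length Vs} \<le> card \<sigma>"
    using h assms(2) by (intro card_inj_on_le) auto
  then show False
    using assms(3) by simp
qed

text \<open>To keep edges rainbow, a vertex may only be exchanged within its own part. A part missed
  by the collapsed face \<sigma> is therefore used, and its index decides which member of the family
  is copied.\<close>

theorem missing_rainbow_hypergraph_directed_weakly_saturated:
  fixes V :: "'a set"
  assumes V: "finite V" and part: "ordered_partition V Vs" and len: "length Vs = d + 1"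
    and ns: "\<And>i. i < d + 1 \<Longrightarrow> card (Vs ! i) = ns ! i"
    and K: "simplicial_complex_on V K" and coll: "collapsible d K"
    and dim: "\<And>i. i < d + 1 \<Longrightarrow> complex_dim (induced_subcomplex K (Vs ! i)) \<le> int (rs ! i) - 1"
  shows "directed_weakly_saturated
    {complete_partite ((replicate (d + 1) 1)[i := ns ! i - rs ! i + 1]) | i. i < d + 1}
    (missing_rainbow_hypergraph Vs K) (complete_partite_on Vs)"
    (is "directed_weakly_saturated ?\<F> ?H ?G")
proof -
  define E where "E = {e. rainbow Vs e}"
  note fK = finite_simplicial_complex[OF K]
  have UV: "\<Union>(set Vs) = V"
    and disj: "\<And>i j. i < d + 1 \<Longrightarrow> j < d + 1 \<Longrightarrow> i \<noteq> j \<Longrightarrow> Vs ! i \<inter> Vs ! j = {}"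
    using part len by (auto simp: ordered_partition_def)
  have VsV: "Vs ! i \<subseteq> V" if "i < d + 1" for i
    using UV that len nth_mem by fastforce
  obtain es where es: "distinct es" "set es = E \<inter> K"
    and steps: "\<forall>k<length es. \<exists>\<sigma> \<tau>. card \<sigma> \<le> d \<and> \<sigma> \<subseteq> es ! k \<and> es ! k \<subseteq> \<tau> \<and> \<tau> \<in> K \<and>
       (\<forall>e\<in>E \<inter> K. \<sigma> \<subseteq> e \<longrightarrow> \<not> e \<subseteq> \<tau> \<longrightarrow> e \<in> set (take k es))"
    using collapse_edge_order[OF coll[unfolded collapsible_def] fK, of E]
    by (elim exE conjE) (rule that)
  have "\<exists>F\<in>?\<F>. \<exists>\<phi>. directed_embedding F (add_edges ?H (set (take (Suc k) es))) \<phi> \<and>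
      (\<exists>f\<in>edges F. \<phi> ` f = es ! k)"
    if k: "k < length es" for k
  proof -
    let ?G' = "add_edges ?H (set (take (Suc k) es))"
    obtain \<sigma> \<tau> where \<sigma>: "card \<sigma> \<le> d" "\<sigma> \<subseteq> es ! k" and \<tau>: "es ! k \<subseteq> \<tau>" "\<tau> \<in> K"
      and new: "\<forall>e\<in>E \<inter> K. \<sigma> \<subseteq> e \<longrightarrow> \<not> e \<subseteq> \<tau> \<longrightarrow> e \<in> set (take k es)"
      using steps[THEN spec, THEN mp, OF k] by (elim exE conjE) (rule that)
    have take: "set (take (Suc k) es) = insert (es ! k) (set (take k es))"
      using k by (simp add: take_Suc_conv_app_nth)
    have present: "e \<in> edges ?G'" if "e \<in> E" "\<sigma> \<subseteq> e" "\<not> e \<subseteq> \<tau>" for e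
      using that new unfolding add_edges_def missing_rainbow_hypergraph_def take E_def by auto
    have ek: "rainbow Vs (es ! k)" "es ! k \<in> edges ?G'"
      using k es(2) nth_mem unfolding add_edges_def take E_def by fastforce+
    have ekV: "es ! k \<subseteq> V"
      using ek(1) UV by (simp add: rainbow_def)
    have "\<forall>j<d + 1. \<exists>x. es ! k \<inter> Vs ! j = {x}"
      using ek(1) len by (simp add: rainbow_def card_1_singleton_iff)
    then obtain s where s: "\<And>j. j < d + 1 \<Longrightarrow> es ! k \<inter> Vs ! j = {s j}"
      by metis
    have "finite \<sigma>"
      using \<sigma>(2) ekV V by (meson finite_subset)
    then obtain i where i: "i < d + 1" "\<sigma> \<inter> Vs ! i = {}"
      using ordered_partition_missed_part[OF part] \<sigma>(1) len by (metis Suc_eq_plus1 less_Suc_eq_le)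
    define S where "S = s ` ({..<d + 1} - {i})"
    \<comment> \<open>Disjointness of the parts leaves the centre with no vertex in part
      \<open>i\<close> and exactly one in each other part.\<close>
    have S_part: "S \<inter> Vs ! j = (if j = i then {} else {s j})" if "j < d + 1" for j
      using that s disj by (auto simp: S_def) blast+
    have inj: "inj_on s ({..<d + 1} - {i})"
    proof (rule inj_onI)
      fix a b assume "a \<in> {..<d + 1} - {i}" "b \<in> {..<d + 1} - {i}" "s a = s b"
      then show "a = b"
        using s[of a] s[of b] disj[of a b] by blast
    qed
    have ek_eq: "insert (s i) S = es ! k"
    proof
      show "insert (s i) S \<subseteq> es ! k"
        using s i(1) by (auto simp: S_def)
      show "es ! k \<subseteq> insert (s i) S"
      proof
        fix x assume x: "x \<in> es ! k"
        then obtain j where j: "j < d + 1" "x \<in> Vs ! j"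
          using ekV UV len by (metis UnionE in_set_conv_nth subsetD)
        then have "x = s j"
          using s x by blast
        then show "x \<in> insert (s i) S"
          using j by (auto simp: S_def)
      qed
    qed
    have si: "s i \<in> es ! k" "s i \<in> Vs ! i"
      using s[OF i(1)] by auto
    have "s i \<notin> \<sigma>"
      using si(2) i(2) by blast
    then have \<sigma>S: "\<sigma> \<subseteq> S"
      using \<sigma>(2) unfolding ek_eq[symmetric] by (simp add: subset_insert)
    have fVi: "finite (Vs ! i)"
      using VsV[OF i(1)] V by (rule finite_subset)
    \<comment> \<open>The dimension hypothesis bounds only the trace of \<tau> on part
      \<open>i\<close>, but the new leaves are sought in that part alone.\<close>
    have "\<tau> \<inter> Vs ! i \<in> induced_subcomplex K (Vs ! i)"
      using K \<tau>(2) by (auto simp: simplicial_complex_on_def induced_subcomplex_def)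
    moreover have "finite (induced_subcomplex K (Vs ! i))"
      using fK by (simp add: induced_subcomplex_def)
    ultimately have "card (\<tau> \<inter> Vs ! i) \<le> rs ! i"
      using card_face_le_of_complex_dim dim[OF i(1)] by blast
    then have "ns ! i - rs ! i \<le> card (Vs ! i - \<tau>)"
      using ns[OF i(1)] fVi by (simp add: card_Diff_subset_Int Int_commute)
    then obtain X0 where X0: "X0 \<subseteq> Vs ! i - \<tau>" "card X0 = ns ! i - rs ! i" "finite X0"
      by (rule obtain_subset_with_card_n)
    define X where "X = insert (s i) X0"
    have XVi: "X \<subseteq> Vs ! i"
      using X0(1) si(2) by (auto simp: X_def)
    have "s i \<notin> X0"
      using si(1) \<tau>(1) X0(1) by blast
    then have cX: "card X = ns ! i - rs ! i + 1"
      using X0 by (simp add: X_def)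
    have XS: "X \<inter> S = {}"
      using XVi S_part[OF i(1)] by auto
    have SV: "S \<subseteq> V"
      using ek_eq ekV by blast
    have XV: "X \<union> S \<subseteq> verts ?G'"
      using XVi VsV[OF i(1)] SV UV by (auto simp: add_edges_def missing_rainbow_hypergraph_def)
    have edge: "insert x S \<in> edges ?G'" if "x \<in> X" for x
    proof (cases "x = s i")
      case True
      then show ?thesis
        using ek(2) ek_eq by simp
    next
      case False
      then have x: "x \<in> Vs ! i" "x \<notin> \<tau>"
        using that X0(1) by (auto simp: X_def)
      \<comment> \<open>Replacing \<open>s i\<close> by another vertex of part \<open>i\<close>
        affects no other part, so the set stays rainbow.\<close>
      have "insert x S \<inter> Vs ! j = {if j = i then x else s j}" if "j < d + 1" for j
        using S_part[OF that] x(1) disj[OF that i(1)] by (cases "j = i") auto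
      then have "rainbow Vs (insert x S)"
        using x(1) VsV[OF i(1)] SV UV len by (auto simp: rainbow_def)
      then show ?thesis
        using present[of "insert x S"] x(2) \<sigma>S by (auto simp: E_def)
    qed
    let ?F = "complete_partite ((replicate (d + 1) 1)[i := card X])"
    have "finite X" "s i \<in> X"
      using X0(3) by (simp_all add: X_def)
    from star_embedding[OF i(1) this inj S_def XS XV edge]
    obtain \<phi> where \<phi>: "embedding ?F ?G' \<phi>" "\<exists>f\<in>edges ?F. \<phi> ` f = insert (s i) S"
      "length (parts ?F) = d + 1"
      "\<And>j. j < d + 1 \<Longrightarrow> \<phi> ` (parts ?F ! j) \<subseteq> (if j = i then X else {s j})"
      by blast
    have pG': "parts ?G' = Vs"
      by (simp add: add_edges_def missing_rainbow_hypergraph_def)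
    have "\<phi> ` (parts ?F ! j) \<subseteq> Vs ! j" if "j < d + 1" for j
      using \<phi>(4)[OF that] XVi s[OF that] by (auto split: if_splits)
    then have "directed_embedding ?F ?G' \<phi>"
      unfolding directed_embedding_def pG' \<phi>(3) using \<phi>(1) len by simp
    then have "\<exists>\<phi>. directed_embedding ?F ?G' \<phi> \<and> (\<exists>f\<in>edges ?F. \<phi> ` f = es ! k)"
      using \<phi>(2) unfolding ek_eq by (intro exI[of _ \<phi>] conjI)
    moreover have "?F \<in> ?\<F>"
      unfolding cX using i(1) by blast
    ultimately show ?thesis
      by (rule bexI)
  qed
  moreover have "edges ?G - edges ?H = E \<inter> K" "verts ?H = verts ?G" "edges ?H \<subseteq> edges ?G"
    "parts ?H = parts ?G"
    by (auto simp: E_def complete_partite_on_def missing_rainbow_hypergraph_def)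
  ultimately show ?thesis
    using es unfolding directed_weakly_saturated_def by (intro conjI exI[of _ es]) simp_all
qed

theorem theorem1p5:
  fixes d :: nat
  shows
   "(\<forall>(V :: 'a set) (n :: nat) (r :: nat) (K :: 'a set set).
       finite V \<and> card V = n \<and> d + r \<le> n \<and>
       simplicial_complex_on V K \<and> collapsible d K \<and>
       complex_dim K \<le> int d + int r - 1 \<longrightarrow>
       weakly_saturated {complete_partite (replicate d 1 @ [n - d - r + 1])}
         (missing_hypergraph (d + 1) V K) (complete_hypergraph (d + 1) V))
    \<and>
    (\<forall>(V :: 'b set) (Vs :: 'b set list) (ns :: nat list) (rs :: nat list) (K :: 'b set set).
       finite V \<and> ordered_partition V Vs \<and>
       length Vs = d + 1 \<and> length ns = d + 1 \<and> length rs = d + 1 \<and>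
       (\<forall>i<d + 1. card (Vs ! i) = ns ! i \<and> rs ! i \<le> ns ! i) \<and>
       simplicial_complex_on V K \<and> collapsible d K \<and>
       (\<forall>i<d + 1. complex_dim (induced_subcomplex K (Vs ! i)) \<le> int (rs ! i) - 1) \<longrightarrow>
       directed_weakly_saturated
         {complete_partite ((replicate (d + 1) 1)[i := ns ! i - rs ! i + 1]) | i. i < d + 1}
         (missing_rainbow_hypergraph Vs K) (complete_partite_on Vs))"
proof (intro conjI allI impI; elim conjE)
  fix V :: "'a set" and n r K
  assume "finite V" "card V = n" "simplicial_complex_on V K" "collapsible d K"
    "complex_dim K \<le> int d + int r - 1"
  then show "weakly_saturated {complete_partite (replicate d 1 @ [n - d - r + 1])}
      (missing_hypergraph (d + 1) V K) (complete_hypergraph (d + 1) V)"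
    using missing_hypergraph_weakly_saturated by blast
next
  fix V :: "'b set" and Vs ns rs K
  assume "finite V" "ordered_partition V Vs" "length Vs = d + 1"
    "\<forall>i<d + 1. card (Vs ! i) = ns ! i \<and> rs ! i \<le> ns ! i"
    "simplicial_complex_on V K" "collapsible d K"
    "\<forall>i<d + 1. complex_dim (induced_subcomplex K (Vs ! i)) \<le> int (rs ! i) - 1"
  then show "directed_weakly_saturated
      {complete_partite ((replicate (d + 1) 1)[i := ns ! i - rs ! i + 1]) | i. i < d + 1}
      (missing_rainbow_hypergraph Vs K) (complete_partite_on Vs)"
    by (intro missing_rainbow_hypergraph_directed_weakly_saturated) auto
qed

end
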